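(* Let $k\ge1$, fix monomials $f_{i,\sigma,\tau}(q)\in\mathbb{Z}[q]$ for $1\le i\le k$, $\sigma\ge1$, $\tau\ge0$, and use the weighted polynomials defined in the context. Then for every $n\ge1$, $$F_n^k(\mathbf z;q)=F_n^{k-1}(\mathbf z;q)+\sum_{j=0}^{n-k}z_k\,f_{k,j+1,n-k-j}(q)\,F_j^{k-1}(\mathbf z\mathbf s^+_{n-j};q)\,F_{n-k-j}^k(\mathbf z\mathbf s^-_{k+j};q).$$
   Context: Cells of an $n\times1$ board are numbered $1,\dots,n$. For $K\ge0$, a tiling of the board by tiles of length at most $K$ is a sequence of tiles of lengths $\ell_1,\dots,\ell_r\in\{1,\dots,K\}$ with $\ell_1+\cdots+\ell_r=n$; the $j$-th tile starts at cell $\sigma_j=1+\ell_1+\cdots+\ell_{j-1}$ and is followed by $\tau_j=n-(\sigma_j+\ell_j-1)$ cells. Let $\mathbf z=(z_1,\dots,z_k)$ be indeterminates. A tile of length $i$ that begins in cell $\sigma$ and is followed by $\tau$ cells has weight $z_i f_{i,\sigma,\tau}(q)$, and the weight of a tiling is the product of the weights of its tiles. For $K\in\{k-1,k\}$ and integers $a,b\ge0$ define $$F_n^K[a,b]=\sum \prod_{j=1}^r z_{\ell_j}\,f_{\ell_j,\,a+\sigma_j,\,b+\tau_j}(q),$$ the sum over all tilings of the $n\times1$ board by tiles of length at most $K$ (the weighted count of tilings of an $n\times 1$ board with an untiled $a\times1$ board appended before it and an untiled $b\times1$ board appended after it). By convention $F_0^K[a,b]=1$ (empty tiling) and $F_n^K[a,b]=0$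 for $n<0$ (and for $K=0$, $F_n^0[a,b]=0$ for $n>0$). Notation: $F_n^K(\mathbf z;q)=F_n^K[0,0]$, $F_n^K(\mathbf z\mathbf s^+_m;q)=F_n^K[0,m]$, $F_n^K(\mathbf z\mathbf s^-_m;q)=F_n^K[m,0]$. *)

theory Defs
  imports Complex_Main "HOL-Library.Poly_Mapping" "HOL-Computational_Algebra.Polynomial"
begin

text \<open>The ring \<open>\<int>[q][z\<^sub>1, z\<^sub>2, \<dots>]\<close>: the exponent vectors of the indeterminates \<open>z\<^sub>i\<close> are finitely
  supported functions, and the coefficients are polynomials in \<open>q\<close>.\<close>

type_synonym zpoly = "(nat \<Rightarrow>\<^sub>0 nat) \<Rightarrow>\<^sub>0 int poly"

definition Z :: "nat \<Rightarrow> zpoly"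
  where "Z i = Poly_Mapping.single (Poly_Mapping.single i 1) 1"

definition Const :: "int poly \<Rightarrow> zpoly"
  where "Const p = Poly_Mapping.single 0 p"

text \<open>Coefficients other than 1 (including 0) are allowed.\<close>

definition is_monomial :: "int poly \<Rightarrow> bool"
  where "is_monomial p \<longleftrightarrow> (\<exists>c d. p = monom c d)"

text \<open>A tiling is the list of its tile lengths, from left to right.\<close>

definition tilings :: "nat \<Rightarrow> nat \<Rightarrow> nat list set"
  where "tilings K n = {ls. set ls \<subseteq> {1..K} \<and> sum_list ls = n}"

text \<open>List positions count from 0, cells from 1. The subtraction in \<open>cells_after\<close> does not truncate
  when \<open>ls\<close> is a tiling of a board with \<open>n\<close> cells and \<open>j < length ls\<close>.\<close>

definition start_cell :: "nat list \<Rightarrow> nat \<Rightarrow> nat"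
  where "start_cell ls j = 1 + sum_list (take j ls)"

definition cells_after :: "nat \<Rightarrow> nat list \<Rightarrow> nat \<Rightarrow> nat"
  where "cells_after n ls j = n - (start_cell ls j + ls ! j - 1)"

text \<open>\<open>F f K n a b\<close> is \<open>F\<^sub>n\<^sup>K[a,b]\<close>. In particular \<open>F f K n 0 m\<close> is \<open>F\<^sub>n\<^sup>K(z s\<^sup>+\<^sub>m; q)\<close> and
  \<open>F f K n m 0\<close> is \<open>F\<^sub>n\<^sup>K(z s\<^sup>-\<^sub>m; q)\<close>.\<close>

definition F :: "(nat \<Rightarrow> nat \<Rightarrow> nat \<Rightarrow> int poly) \<Rightarrow> nat \<Rightarrow> nat \<Rightarrow> nat \<Rightarrow> nat \<Rightarrow> zpoly"
  where "F f K n a b =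
    (\<Sum>ls\<in>tilings K n. \<Prod>j<length ls.
       Z (ls ! j) * Const (f (ls ! j) (a + start_cell ls j) (b + cells_after n ls j)))"

lemma length_le_sum_list:
  assumes "set ls \<subseteq> {1..K}"
  shows "length ls \<le> sum_list (ls :: nat list)"
  using assms by (induction ls) auto

lemma finite_tilings: "finite (tilings K n)"
proof (rule finite_subset)
  show "tilings K n \<subseteq> {ls. set ls \<subseteq> {1..K} \<and> length ls \<le> n}"
    using length_le_sum_list[of _ K] unfolding tilings_def by blast
  show "finite {ls. set ls \<subseteq> {1..K} \<and> length ls \<le> n}"
    by (rule finite_lists_length_le) simp
qed

lemma F_0: "F f K 0 a b = 1"
proof -
  have "tilings K 0 = {[]}"
  proof
    show "tilings K 0 \<subseteq> {[]}"
    proof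
      fix ls assume "ls \<in> tilings K 0"
      then have "length ls \<le> 0"
        using length_le_sum_list[of ls K] unfolding tilings_def by (metis (mono_tags, lifting) mem_Collect_eq)
      then show "ls \<in> {[]}" by simp
    qed
    show "{[]} \<subseteq> tilings K 0" by (simp add: tilings_def)
  qed
  then show ?thesis by (simp add: F_def)
qed

lemma F_no_tiles: "n > 0 \<Longrightarrow> F f 0 n a b = 0"
proof -
  assume "n > 0"
  then have "tilings 0 n = {}" by (simp add: tilings_def)
  then show ?thesis by (simp add: F_def)
qed

end

theory Submission
  imports Defs
begin

text \<open>A tiling that uses a tile of length \<open>k\<close> factors uniquely at its first such tile: the tiles to
  the left have length at most \<open>k - 1\<close>, those to the right are unrestricted, and the weight is
  multiplicative along the factorization.\<close>

text \<open>Recursive form of the product in \<open>F\<close>, suited to list induction: cells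
  already passed are moved into the left offset, and the cells still to come are read off the tail,
  so neither tile indices nor truncated subtraction occur.\<close>

fun tiling_weight :: "(nat \<Rightarrow> nat \<Rightarrow> nat \<Rightarrow> int poly) \<Rightarrow> nat \<Rightarrow> nat \<Rightarrow> nat list \<Rightarrow> zpoly" where
  "tiling_weight f a b [] = 1"
| "tiling_weight f a b (l # ls) =
     Z l * Const (f l (a + 1) (b + sum_list ls)) * tiling_weight f (a + l) b ls"

text \<open>Each factor sees the board of the other one only as an untiled extension on its right or
  left. This is the source of the shifts in the recurrence.\<close>

lemma tiling_weight_append:
  "tiling_weight f a b (xs @ ys) =
     tiling_weight f a (b + sum_list ys) xs * tiling_weight f (a + sum_list xs) b ys"
  by (induction xs arbitrary: a) (simp_all add: ac_simps)

lemma prod_tiles_eq_tiling_weight: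
  "(\<Prod>j<length ls. Z (ls ! j) *
      Const (f (ls ! j) (a + start_cell ls j) (b + cells_after (sum_list ls) ls j))) =
   tiling_weight f a b ls"
proof (induction ls arbitrary: a)
  case (Cons l ls)
  \<comment> \<open>Dropping the first tile moves every later start cell by \<open>l\<close>, which
    the offset \<open>a + l\<close> absorbs; hence \<open>a\<close> is arbitrary in the induction.
    The counts of following cells do not change.\<close>
  have "start_cell (l # ls) (Suc j) = l + start_cell ls j" for j
    by (simp add: start_cell_def)
  moreover have "cells_after (sum_list (l # ls)) (l # ls) (Suc j) = cells_after (sum_list ls) ls j" for j
    by (simp add: start_cell_def cells_after_def)
  moreover have "start_cell (l # ls) 0 = 1"
    "cells_after (sum_list (l # ls)) (l # ls) 0 = sum_list ls"
    by (simp_all add: start_cell_def cells_after_def)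
  ultimately show ?case
    using Cons.IH[of "a + l"]
    by (simp add: prod.lessThan_Suc_shift add.assoc
        del: sum_list.Cons prod.lessThan_Suc)
qed simp

lemma F_eq_sum_tiling_weight: "F f K n a b = (\<Sum>ls\<in>tilings K n. tiling_weight f a b ls)"
  unfolding F_def
  by (rule sum.cong) (auto simp: tilings_def simp flip: prod_tiles_eq_tiling_weight)

text \<open>The component \<open>j\<close> is determined by \<open>xs\<close>, but carrying it lets
  the sum be grouped by the position of the tile. The condition \<open>j + k \<le> n\<close> makes
  the range empty when \<open>n < k\<close>, whereas \<open>{0..n - k}\<close> would still contain
  0.\<close>

lemma bij_betw_first_longest_tile:
  assumes "k \<ge> 1"
  shows "bij_betw (\<lambda>(j, xs, ys). xs @ k # ys)
    (SIGMA j:{j. j + k \<le> n}. tilings (k - 1) j \<times> tilings k (n - k - j))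
    (tilings k n - tilings (k - 1) n)"
  (is "bij_betw ?g ?A ?B")
proof -
  have no_k: "k \<notin> set xs" if "xs \<in> tilings (k - 1) j" for xs j
    using that assms by (auto simp: tilings_def)
  have "inj_on ?g ?A"
  proof (rule inj_onI)
    fix p p' assume in_A: "p \<in> ?A" "p' \<in> ?A" and eq: "?g p = ?g p'"
    obtain j xs ys where p: "p = (j, xs, ys)" by (cases p)
    obtain j' xs' ys' where p': "p' = (j', xs', ys')" by (cases p')
    have xs: "xs \<in> tilings (k - 1) j" "xs' \<in> tilings (k - 1) j'"
      using in_A p p' by auto
    \<comment> \<open>Since \<open>k\<close> does not occur in \<open>xs\<close>, the prefix before
      the first \<open>k\<close> recovers \<open>xs\<close> from the concatenation.\<close>
    then have "takeWhile (\<lambda>x. x \<noteq> k) (xs @ k # ys) = xs"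
      "takeWhile (\<lambda>x. x \<noteq> k) (xs' @ k # ys') = xs'"
      using no_k by (auto simp: takeWhile_append)
    then have "xs = xs'" "ys = ys'"
      using eq p p' by auto
    moreover from this xs have "j = j'"
      by (auto simp: tilings_def)
    ultimately show "p = p'"
      using p p' by simp
  qed
  moreover have "?g ` ?A \<subseteq> ?B"
    using assms by (fastforce simp: tilings_def)
  moreover have "?B \<subseteq> ?g ` ?A"
  proof
    fix ls assume "ls \<in> ?B"
    then have ls: "set ls \<subseteq> {1..k}" "sum_list ls = n" "\<not> set ls \<subseteq> {1..k - 1}"
      by (auto simp: tilings_def)
    moreover have "{1..k} = insert k {1..k - 1}"
      using assms by auto
    ultimately have "k \<in> set ls"
      by auto
    then obtain xs ys where split: "ls = xs @ k # ys" "k \<notin> set xs"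
      by (meson split_list_first)
    have "set xs \<subseteq> {1..k - 1}"
    proof
      fix x assume "x \<in> set xs"
      moreover from this have "x \<noteq> k" "x \<in> {1..k}"
        using split ls(1) by auto
      ultimately show "x \<in> {1..k - 1}"
        by auto
    qed
    then have "(sum_list xs, xs, ys) \<in> ?A"
      using split ls by (auto simp: tilings_def)
    then show "ls \<in> ?g ` ?A"
      using split by force
  qed
  ultimately show ?thesis
    by (simp add: bij_betw_def subset_antisym)
qed

lemma F_first_longest_tile:
  assumes "k \<ge> 1"
  shows "F f k n a b = F f (k - 1) n a b
    + (\<Sum>j\<in>{j. j + k \<le> n}. Z k * Const (f k (a + j + 1) (b + (n - k - j)))
         * F f (k - 1) j a (b + (n - j)) * F f k (n - k - j) (a + k + j) b)"
proof -
  let ?c = "\<lambda>j. Z k * Const (f k (a + j + 1) (b + (n - k - j)))"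
  let ?A = "\<lambda>j. tilings (k - 1) j \<times> tilings k (n - k - j)"
  have fin: "finite {j. j + k \<le> n}"
    by (rule finite_subset[of _ "{..n}"]) auto
  have "(\<Sum>ls\<in>tilings k n - tilings (k - 1) n. tiling_weight f a b ls) =
      (\<Sum>(j, xs, ys)\<in>(SIGMA j:{j. j + k \<le> n}. ?A j). tiling_weight f a b (xs @ k # ys))"
    using sum.reindex_bij_betw[OF bij_betw_first_longest_tile[OF assms], of "tiling_weight f a b" n]
    by (simp add: case_prod_unfold)
  also have "\<dots> = (\<Sum>j\<in>{j. j + k \<le> n}. \<Sum>(xs, ys)\<in>?A j. tiling_weight f a b (xs @ k # ys))"
    using fin finite_tilings by (subst sum.Sigma) auto
  also have "\<dots> = (\<Sum>j\<in>{j. j + k \<le> n}. ?c j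
      * F f (k - 1) j a (b + (n - j)) * F f k (n - k - j) (a + k + j) b)"
  proof (rule sum.cong[OF refl])
    fix j assume j: "j \<in> {j. j + k \<le> n}"
    have "tiling_weight f a b (xs @ k # ys) =
        ?c j * (tiling_weight f a (b + (n - j)) xs * tiling_weight f (a + k + j) b ys)"
      if "xs \<in> tilings (k - 1) j" "ys \<in> tilings k (n - k - j)" for xs ys
    proof -
      \<comment> \<open>The last equation gives the right offset for \<open>xs\<close>: it is
        followed by the tile of length \<open>k\<close> and all cells of \<open>ys\<close>, which
        are \<open>n - j\<close> cells together.\<close>
      have "sum_list xs = j" "sum_list ys = n - k - j" "k + (n - k - j) = n - j"
        using that j by (auto simp: tilings_def)
      then show ?thesis
        by (simp add: tiling_weight_append ac_simps)
    qed
    then have "(\<Sum>(xs, ys)\<in>?A j. tiling_weight f a b (xs @ k # ys)) =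
        (\<Sum>(xs, ys)\<in>?A j.
          ?c j * (tiling_weight f a (b + (n - j)) xs * tiling_weight f (a + k + j) b ys))"
      by (intro sum.cong) auto
    also have "\<dots> = ?c j * (F f (k - 1) j a (b + (n - j)) * F f k (n - k - j) (a + k + j) b)"
      unfolding F_eq_sum_tiling_weight sum_product sum.cartesian_product
      by (simp add: case_prod_unfold sum_distrib_left)
    finally show "(\<Sum>(xs, ys)\<in>?A j. tiling_weight f a b (xs @ k # ys)) =
        ?c j * F f (k - 1) j a (b + (n - j)) * F f k (n - k - j) (a + k + j) b"
      by (simp add: mult.assoc)
  qed
  finally have "(\<Sum>ls\<in>tilings k n - tilings (k - 1) n. tiling_weight f a b ls) = \<dots>" .
  moreover have "tilings (k - 1) n \<subseteq> tilings k n"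
    by (fastforce simp: tilings_def)
  ultimately show ?thesis
    \<comment> \<open>The tilings without a tile of length \<open>k\<close> contribute the term
      \<open>F f (k - 1) n a b\<close>; the rest is the sum just computed.\<close>
    using sum.subset_diff[OF _ finite_tilings, of "tilings (k - 1) n" k n "tiling_weight f a b"]
    by (simp add: F_eq_sum_tiling_weight add.commute)
qed

theorem theorem2p4:
  fixes k n :: nat and f :: "nat \<Rightarrow> nat \<Rightarrow> nat \<Rightarrow> int poly"
  assumes "k \<ge> 1"
    and "\<And>i \<sigma> \<tau>. 1 \<le> i \<Longrightarrow> i \<le> k \<Longrightarrow> \<sigma> \<ge> 1 \<Longrightarrow> is_monomial (f i \<sigma> \<tau>)"
    and "n \<ge> 1"
  shows "F f k n 0 0 = F f (k - 1) n 0 0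
    + (\<Sum>j\<in>{j. j + k \<le> n}. Z k * Const (f k (j + 1) (n - k - j))
         * F f (k - 1) j 0 (n - j) * F f k (n - k - j) (k + j) 0)"
  using F_first_longest_tile[OF assms(1), of f n 0 0] by simp

end
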